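(* Let $n\geq2$. Let $F:\mathbb{R}^2\to\mathbb{R}^{n+1}$ be a quadratic form given by $$F(x,y)=\left(x^2,\ c^1y^2+2\gamma^1xy,\ \ldots,\ c^ny^2+2\gamma^nxy\right),$$ where the real constants $c^i,\gamma^i$ satisfy $$(c^1)^2+\cdots+(c^n)^2=1,\quad c^1\gamma^1+\cdots+c^n\gamma^n=0,\quad(\gamma^1)^2+\cdots+(\gamma^n)^2=\tfrac12.$$ Then, up to orthogonal transformations of the domain and/or the codomain, the map $\phi:\mathbb{S}^1\to\mathbb{S}^n$ obtained by restricting $F$ is the only proper biharmonic quadratic form from $\mathbb{S}^1$ to $\mathbb{S}^n$; that is, $\phi$ is proper biharmonic, and every proper biharmonic quadratic form $\mathbb{S}^1\to\mathbb{S}^n$ coincides with $\phi$ after composing with orthogonal transformations of $\mathbb{R}^2$ and/or $\mathbb{R}^{n+1}$. Moreover, the image of $\phi$ is a circle of radius $1/\sqrt2$ of $\mathbb{S}^n$.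
   Context: $\mathbb{S}^m$ is the unit sphere in $\mathbb{R}^{m+1}$ with its round metric. A quadratic form from $\mathbb{S}^m$ to $\mathbb{S}^n$ is a non-constant map $\phi:\mathbb{S}^m\to\mathbb{S}^n$ which is the restriction of a map $F:\mathbb{R}^{m+1}\to\mathbb{R}^{n+1}$ all of whose components are homogeneous polynomials of degree $2$ and with $F(\mathbb{S}^m)\subset\mathbb{S}^n$. For a smooth map $\phi:(M,g)\to(N,h)$ between Riemannian manifolds, the tension field is $\tau(\phi)=\operatorname{trace}\nabla d\phi$ and the bitension field is $\tau_2(\phi)=-\Delta\tau(\phi)-\operatorname{trace}R^N(d\phi(\cdot),\tau(\phi))d\phi(\cdot)$, where $\Delta\sigma=-\operatorname{trace}_g\nabla^2\sigma$ is the rough Laplacian on sections of $\phi^{-1}TN$ and $R(X,Y)Z=\nabla_X\nabla_YZ-\nabla_Y\nabla_XZ-\nabla_{[X,Y]}Z$. The map $\phi$ is harmonic if $\tau(\phi)=0$, biharmonic if $\tau_2(\phi)=0$, and proper biharmonic if it is biharmonic and not harmonic. *)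

theory Defs
  imports "HOL-Analysis.Analysis"
begin

text \<open>
  The Riemannian geometry below is that of the unit spheres \<open>sphere 0 1\<close> of Euclidean spaces with
  the induced (round) metric. The tangent space at \<open>p\<close> is the orthogonal complement of \<open>p\<close>, tangent
  vectors are vectors of the ambient space, and the Levi-Civita connection is the tangential part
  of the ambient derivative. Maps, vector fields and sections are represented by total functions;
  only their values on the sphere matter, and they are understood to be smooth there.
\<close>

definition tangent_space :: "'a::euclidean_space \<Rightarrow> 'a set" where
  "tangent_space p = {v. v \<bullet> p = 0}"

definition tangential :: "'a::euclidean_space \<Rightarrow> 'a \<Rightarrow> 'a" where
  "tangential p v = v - (v \<bullet> p) *\<^sub>R p"

text \<open>
  The differential at \<open>p\<close>, applied to a tangent vector \<open>v\<close>, of a map defined on the unit sphere. The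
  map is first extended to a neighbourhood of the sphere by making it constant along rays, so that
  values off the sphere play no role.
\<close>

definition sphere_deriv :: "('a::euclidean_space \<Rightarrow> 'b::real_normed_vector) \<Rightarrow> 'a \<Rightarrow> 'a \<Rightarrow> 'b" where
  "sphere_deriv f p v = frechet_derivative (\<lambda>x. f (x /\<^sub>R norm x)) (at p) v"

text \<open>
  The connection induced on the pull-back bundle of a map \<open>\<phi>\<close> between unit spheres: the covariant
  derivative at \<open>p\<close> in direction \<open>v\<close> of a section \<open>\<sigma>\<close>, where \<open>\<sigma> q\<close> is tangent at \<open>\<phi> q\<close>.
\<close>

definition pullback_nabla ::
  "('a::euclidean_space \<Rightarrow> 'b::euclidean_space) \<Rightarrow> 'a \<Rightarrow> ('a \<Rightarrow> 'b) \<Rightarrow> 'a \<Rightarrow> 'b" where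
  "pullback_nabla \<phi> v \<sigma> p = tangential (\<phi> p) (sphere_deriv \<sigma> p v)"

definition sphere_nabla ::
  "('a::euclidean_space \<Rightarrow> 'a) \<Rightarrow> ('a \<Rightarrow> 'a) \<Rightarrow> 'a \<Rightarrow> 'a" where
  "sphere_nabla X Y p = tangential p (sphere_deriv Y p (X p))"

definition lie_bracket ::
  "('a::euclidean_space \<Rightarrow> 'a) \<Rightarrow> ('a \<Rightarrow> 'a) \<Rightarrow> 'a \<Rightarrow> 'a" where
  "lie_bracket X Y p = sphere_deriv Y p (X p) - sphere_deriv X p (Y p)"

text \<open>
  A tangent vector \<open>v\<close> at a point is extended to the tangential projection of the constant field \<open>v\<close>.
  The tensors below do not depend on the choice of the extension.
\<close>

definition vf_ext :: "'a::euclidean_space \<Rightarrow> 'a \<Rightarrow> 'a" where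
  "vf_ext v = (\<lambda>q. tangential q v)"

definition curvature_field ::
  "('a::euclidean_space \<Rightarrow> 'a) \<Rightarrow> ('a \<Rightarrow> 'a) \<Rightarrow> ('a \<Rightarrow> 'a) \<Rightarrow> 'a \<Rightarrow> 'a" where
  "curvature_field X Y Z p =
     sphere_nabla X (sphere_nabla Y Z) p - sphere_nabla Y (sphere_nabla X Z) p
       - sphere_nabla (lie_bracket X Y) Z p"

definition curvature :: "'a::euclidean_space \<Rightarrow> 'a \<Rightarrow> 'a \<Rightarrow> 'a \<Rightarrow> 'a" where
  "curvature p u v w = curvature_field (vf_ext u) (vf_ext v) (vf_ext w) p"

definition orthonormal_basis :: "'a::euclidean_space set \<Rightarrow> 'a set \<Rightarrow> bool" where
  "orthonormal_basis V B \<longleftrightarrow>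
     B \<subseteq> V \<and> pairwise orthogonal B \<and> (\<forall>b\<in>B. norm b = 1) \<and> span B = V"

text \<open>The trace of a bilinear map on \<open>V\<close> is independent of the chosen orthonormal basis.\<close>

definition trace_on :: "'a::euclidean_space set \<Rightarrow> ('a \<Rightarrow> 'a \<Rightarrow> 'b::real_vector) \<Rightarrow> 'b" where
  "trace_on V h = (\<Sum>e\<in>(SOME B. orthonormal_basis V B). h e e)"

text \<open>\<open>(\<nabla> d\<phi>)(v, w)\<close> at the point \<open>p\<close>.\<close>

definition nabla_d ::
  "('a::euclidean_space \<Rightarrow> 'b::euclidean_space) \<Rightarrow> 'a \<Rightarrow> 'a \<Rightarrow> 'a \<Rightarrow> 'b" where
  "nabla_d \<phi> p v w =
     pullback_nabla \<phi> v (\<lambda>q. sphere_deriv \<phi> q (vf_ext w q)) p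
       - sphere_deriv \<phi> p (sphere_nabla (vf_ext v) (vf_ext w) p)"

definition tension :: "('a::euclidean_space \<Rightarrow> 'b::euclidean_space) \<Rightarrow> 'a \<Rightarrow> 'b" where
  "tension \<phi> p = trace_on (tangent_space p) (nabla_d \<phi> p)"

text \<open>\<open>(\<nabla>\<^sup>2 \<sigma>)(v, w)\<close> at the point \<open>p\<close>, for a section \<open>\<sigma>\<close> along \<open>\<phi>\<close>.\<close>

definition nabla2 ::
  "('a::euclidean_space \<Rightarrow> 'b::euclidean_space) \<Rightarrow> ('a \<Rightarrow> 'b) \<Rightarrow> 'a \<Rightarrow> 'a \<Rightarrow> 'a \<Rightarrow> 'b" where
  "nabla2 \<phi> \<sigma> p v w =
     pullback_nabla \<phi> v (\<lambda>q. pullback_nabla \<phi> (vf_ext w q) \<sigma> q) p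
       - pullback_nabla \<phi> (sphere_nabla (vf_ext v) (vf_ext w) p) \<sigma> p"

definition rough_laplacian ::
  "('a::euclidean_space \<Rightarrow> 'b::euclidean_space) \<Rightarrow> ('a \<Rightarrow> 'b) \<Rightarrow> 'a \<Rightarrow> 'b" where
  "rough_laplacian \<phi> \<sigma> p = - trace_on (tangent_space p) (nabla2 \<phi> \<sigma> p)"

definition bitension :: "('a::euclidean_space \<Rightarrow> 'b::euclidean_space) \<Rightarrow> 'a \<Rightarrow> 'b" where
  "bitension \<phi> p =
     - rough_laplacian \<phi> (tension \<phi>) p
     - trace_on (tangent_space p)
         (\<lambda>v w. curvature (\<phi> p) (sphere_deriv \<phi> p v) (tension \<phi> p) (sphere_deriv \<phi> p w))"

text \<open>The next three notions are meant for smooth maps from the unit sphere to the unit sphere.\<close>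

definition harmonic_map :: "('a::euclidean_space \<Rightarrow> 'b::euclidean_space) \<Rightarrow> bool" where
  "harmonic_map \<phi> \<longleftrightarrow> (\<forall>p\<in>sphere 0 1. tension \<phi> p = 0)"

definition biharmonic_map :: "('a::euclidean_space \<Rightarrow> 'b::euclidean_space) \<Rightarrow> bool" where
  "biharmonic_map \<phi> \<longleftrightarrow> (\<forall>p\<in>sphere 0 1. bitension \<phi> p = 0)"

definition proper_biharmonic :: "('a::euclidean_space \<Rightarrow> 'b::euclidean_space) \<Rightarrow> bool" where
  "proper_biharmonic \<phi> \<longleftrightarrow> biharmonic_map \<phi> \<and> \<not> harmonic_map \<phi>"

definition homogeneous_quadratic_poly :: "('a::euclidean_space \<Rightarrow> real) \<Rightarrow> bool" where
  "homogeneous_quadratic_poly f \<longleftrightarrow>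
     (\<exists>a. \<forall>x. f x = (\<Sum>i\<in>Basis. \<Sum>j\<in>Basis. a i j * (x \<bullet> i) * (x \<bullet> j)))"

definition quadratic_form_spheres :: "('a::euclidean_space \<Rightarrow> 'b::euclidean_space) \<Rightarrow> bool" where
  "quadratic_form_spheres \<phi> \<longleftrightarrow>
     (\<exists>F. (\<forall>b\<in>Basis. homogeneous_quadratic_poly (\<lambda>x. F x \<bullet> b))
        \<and> F ` sphere 0 1 \<subseteq> sphere 0 1
        \<and> (\<forall>p\<in>sphere 0 1. \<phi> p = F p))
     \<and> \<not> \<phi> constant_on sphere 0 1"

text \<open>
  A circle of the unit sphere; its radius is measured in the ambient Euclidean space.
\<close>

definition circle_of_sphere :: "real \<Rightarrow> 'b::euclidean_space set \<Rightarrow> bool" where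
  "circle_of_sphere r C \<longleftrightarrow>
     C \<subseteq> sphere 0 1 \<and>
     (\<exists>P a. affine P \<and> aff_dim P = 2 \<and> a \<in> P \<and> C = sphere a r \<inter> P)"

end

theory Submission
  imports Defs
begin

text \<open>
  On the unit circle the squares and products of the coordinates are affine functions of
  \<open>cos 2t\<close> and \<open>sin 2t\<close>, so a quadratic form is \<open>\<psi>(t) = A + cos 2t B + sin 2t C\<close>. The condition
  \<open>|\<psi>| = 1\<close> forces \<open>A\<close>, \<open>B\<close>, \<open>C\<close> to be pairwise orthogonal with \<open>|B| = |C| = r\<close> and
  \<open>|A|\<^sup>2 = 1 - r\<^sup>2\<close>. So \<open>\<psi>\<close> runs twice, at constant speed \<open>2r\<close>, around a circle of radius \<open>r\<close>
  (\<open>quadratic_form_spheres_iff\<close>, \<open>circle_of_sphere_image_\<phi>\<close>).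

  For such a curve everything is explicit. Write \<open>W = cos 2t B + sin 2t C\<close>. The tension field is
  the tangential part of \<open>\<psi>'' = - 4 W\<close>, that is \<open>4 (r\<^sup>2 A + (r\<^sup>2 - 1) W)\<close>, which vanishes only for a
  great circle, \<open>r = 1\<close> (\<open>tension_\<phi>\<close>). Differentiating covariantly twice multiplies it by
  \<open>- 4 (1 - r\<^sup>2)\<close> (\<open>nabla2_tension_\<phi>\<close>), and since the sphere has curvature one and the tension is
  orthogonal to the velocity of length \<open>2r\<close>, the curvature term contributes the factor \<open>4 r\<^sup>2\<close>
  (\<open>curvature_tension_\<phi>\<close>). Hence the bitension is \<open>4 (2 r\<^sup>2 - 1)\<close> times the tension, and the proper
  biharmonic quadratic forms are exactly those with \<open>r\<^sup>2 = 1/2\<close> (\<open>proper_biharmonic_\<phi>_iff\<close>).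

  For the form of the theorem \<open>A = (1/2, c/2)\<close>, \<open>B = (1/2, - c/2)\<close>, \<open>C = (0, \<gamma>)\<close>, and the conditions
  on \<open>c\<close> and \<open>\<gamma>\<close> make these vectors pairwise orthogonal with \<open>r\<^sup>2 = 1/2\<close>. Two curves with the same \<open>r\<close> have triples \<open>(A, B, C)\<close> with the
  same Gram matrix, so an orthogonal transformation of the codomain carries one to the other
  (\<open>spherical_double_angle_circles_congruent\<close>).
\<close>

section \<open>Configurations of vectors with equal Gram matrices\<close>

lemma orthogonal_transformation_reflection:
  fixes u :: "'a::euclidean_space"
  shows "orthogonal_transformation (\<lambda>x. x - (2 * (x \<bullet> u) / (u \<bullet> u)) *\<^sub>R u)"
proof -
  define k where "k x = 2 * (x \<bullet> u) / (u \<bullet> u)" for x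
  have k: "k x * (u \<bullet> u) = 2 * (x \<bullet> u)" for x
    by (cases "u = 0") (simp_all add: k_def)
  have "linear (\<lambda>x. x - k x *\<^sub>R u)"
    by (rule linearI) (simp_all add: k_def inner_add_left distrib_left add_divide_distrib algebra_simps)
  moreover have "(x - k x *\<^sub>R u) \<bullet> (y - k y *\<^sub>R u) = x \<bullet> y" for x y
  proof -
    have "(x - k x *\<^sub>R u) \<bullet> (y - k y *\<^sub>R u) =
        x \<bullet> y - k y * (x \<bullet> u) - k x * (y \<bullet> u) + k y * (k x * (u \<bullet> u))"
      by (simp add: inner_diff inner_commute algebra_simps)
    also have "k x * (y \<bullet> u) = k y * (x \<bullet> u)"
      by (simp add: k_def)
    finally show ?thesis
      by (simp add: k)
  qed
  ultimately show ?thesis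
    unfolding orthogonal_transformation_def k_def by blast
qed

text \<open>
  Induction on the index set: if \<open>T\<close> already matches the vectors with index in \<open>I\<close>, then \<open>T (f k)\<close> and
  \<open>g k\<close> have the same length and the same inner products with all \<open>g i\<close>. The reflection that swaps
  them is along their difference, which is orthogonal to every \<open>g i\<close>, so it leaves these fixed.
\<close>

lemma orthogonal_transformation_of_gram_eq:
  fixes f g :: "'i \<Rightarrow> 'a::euclidean_space"
  assumes "finite I" and "\<And>i j. i \<in> I \<Longrightarrow> j \<in> I \<Longrightarrow> f i \<bullet> f j = g i \<bullet> g j"
  shows "\<exists>T. orthogonal_transformation T \<and> (\<forall>i\<in>I. T (f i) = g i)"
  using assms
proof (induction I)
  case empty
  show ?case by (auto intro: exI[of _ "\<lambda>x. x"])
next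
  case (insert k I)
  then obtain T where T: "orthogonal_transformation T" "\<forall>i\<in>I. T (f i) = g i" by auto
  define u where "u = T (f k) - g k"
  define R where "R x = x - (2 * (x \<bullet> u) / (u \<bullet> u)) *\<^sub>R u" for x
  have R: "orthogonal_transformation R"
    unfolding R_def by (rule orthogonal_transformation_reflection)
  have Tin: "T x \<bullet> T y = x \<bullet> y" for x y
    using T by (simp add: orthogonal_transformation_def)
  have "R (g i) = g i" if "i \<in> I" for i
  proof -
    have "g i \<bullet> T (f k) = f i \<bullet> f k" using T(2) Tin that by metis
    then have "g i \<bullet> u = 0" using insert.prems that by (simp add: u_def inner_diff_right)
    then show ?thesis by (simp add: R_def)
  qed
  moreover have "R (T (f k)) = g k"
  proof (cases "u = 0")
    case False
    have "T (f k) \<bullet> T (f k) = g k \<bullet> g k" using insert.prems Tin by simp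
    then have "2 * (T (f k) \<bullet> u) = u \<bullet> u"
      by (simp add: u_def inner_diff inner_commute)
    then show ?thesis using False by (simp add: R_def) (simp add: u_def)
  qed (simp add: R_def u_def)
  ultimately have "\<forall>i\<in>insert k I. (R \<circ> T) (f i) = g i" using T(2) by simp
  moreover have "orthogonal_transformation (R \<circ> T)"
    using R T(1) by (rule orthogonal_transformation_compose)
  ultimately show ?case by blast
qed

section \<open>Connection and curvature of the unit sphere\<close>

text \<open>
  The radial retraction is the extension used to define derivatives on the sphere; its own derivative
  is the orthogonal projection onto the tangent space.
\<close>

lemma has_derivative_normalize:
  fixes p :: "'a::euclidean_space"
  assumes "norm p = 1"
  shows "((\<lambda>x. x /\<^sub>R norm x) has_derivative tangential p) (at p)"
proof -
  have "p \<noteq> 0" using assms by auto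
  then have "(norm has_derivative (\<lambda>v. v \<bullet> p)) (at p)"
    using assms has_derivative_norm[of p] by (simp add: sgn_div_norm inner_commute)
  then show ?thesis
    using assms unfolding tangential_def
    by (auto intro!: derivative_eq_intros simp: fun_eq_iff sgn_div_norm inner_commute)
qed

text \<open>
  Every derivative on the sphere below is computed through this lemma: any differentiable extension
  \<open>G\<close> of \<open>f\<close> to the ambient space may replace the radially constant one.
\<close>

lemma sphere_deriv_eqI:
  fixes f :: "'a::euclidean_space \<Rightarrow> 'b::real_normed_vector"
  assumes "norm p = 1" and G: "(G has_derivative G') (at p)"
    and "\<And>q. norm q = 1 \<Longrightarrow> f q = G q"
  shows "sphere_deriv f p v = G' (tangential p v)"
proof -
  have "p \<noteq> 0" using assms by auto
  have "((G \<circ> (\<lambda>x. x /\<^sub>R norm x)) has_derivative (G' \<circ> tangential p)) (at p)"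
    using assms by (intro diff_chain_at has_derivative_normalize) auto
  moreover have "\<forall>\<^sub>F x in at p. (G \<circ> (\<lambda>x. x /\<^sub>R norm x)) x = f (x /\<^sub>R norm x)"
    using eventually_neq_at_within[of 0 p UNIV]
    by (rule eventually_mono) (use assms(3) in auto)
  ultimately have "((\<lambda>x. f (x /\<^sub>R norm x)) has_derivative (G' \<circ> tangential p)) (at p)"
    by (rule has_derivative_transform_eventually) (use assms in auto)
  then show ?thesis
    unfolding sphere_deriv_def by (simp add: frechet_derivative_at[symmetric])
qed

lemma sphere_deriv_vf_ext:
  fixes p :: "'a::euclidean_space"
  assumes "norm p = 1"
  shows "sphere_deriv (vf_ext v) p t = - (v \<bullet> tangential p t) *\<^sub>R p - (v \<bullet> p) *\<^sub>R tangential p t"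
  by (rule sphere_deriv_eqI[OF assms, where G="vf_ext v"])
    (auto intro!: derivative_eq_intros simp: vf_ext_def tangential_def)

lemma tangential_self: "norm p = 1 \<Longrightarrow> tangential p p = 0"
  by (simp add: tangential_def norm_eq_1)

lemma tangential_tangent: "v \<bullet> p = 0 \<Longrightarrow> tangential p v = v"
  by (simp add: tangential_def)

lemma tangential_scaleR: "tangential p (a *\<^sub>R v) = a *\<^sub>R tangential p v"
  by (simp add: tangential_def algebra_simps)

lemma tangential_diff: "tangential p (v - w) = tangential p v - tangential p w"
  by (simp add: tangential_def algebra_simps)

lemma tangential_idem: "norm p = 1 \<Longrightarrow> tangential p (tangential p v) = tangential p v"
  by (simp add: tangential_def algebra_simps norm_eq_1)

lemma sphere_nabla_vf_ext:
  fixes p :: "'a::euclidean_space"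
  assumes "norm p = 1"
  shows "sphere_nabla (vf_ext u) (vf_ext v) p = - (v \<bullet> p) *\<^sub>R tangential p u"
  unfolding sphere_nabla_def sphere_deriv_vf_ext[OF assms]
  by (simp only: tangential_diff tangential_scaleR)
     (simp add: vf_ext_def tangential_idem tangential_self assms)

text \<open>
  By \<open>sphere_nabla_vf_ext\<close> the inner covariant derivative is the field \<open>q \<mapsto> - (w \<bullet> q) tangential q v\<close>
  on the sphere. At \<open>p\<close> the factor \<open>w \<bullet> q\<close> vanishes, so only its derivative contributes.
\<close>

lemma sphere_nabla_nabla_vf_ext:
  fixes p :: "'a::euclidean_space"
  assumes p: "norm p = 1" and "u \<bullet> p = 0" "v \<bullet> p = 0" "w \<bullet> p = 0"
  shows "sphere_nabla (vf_ext u) (sphere_nabla (vf_ext v) (vf_ext w)) p = - (w \<bullet> u) *\<^sub>R v"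
proof -
  have "sphere_deriv (sphere_nabla (vf_ext v) (vf_ext w)) p t = - (w \<bullet> tangential p t) *\<^sub>R v" for t
    by (rule sphere_deriv_eqI[OF p, where G="\<lambda>q. - (w \<bullet> q) *\<^sub>R tangential q v"])
      (use assms in \<open>auto intro!: derivative_eq_intros
        simp: sphere_nabla_vf_ext tangential_def\<close>)
  then show ?thesis
    using assms by (simp add: sphere_nabla_def vf_ext_def tangential_def)
qed

text \<open>
  Constant sectional curvature one. The bracket of the two extended fields vanishes at \<open>p\<close>,
  which leaves only the commutator of the second derivatives.
\<close>

lemma curvature_sphere:
  fixes p :: "'a::euclidean_space"
  assumes p: "norm p = 1" and "u \<bullet> p = 0" "v \<bullet> p = 0" "w \<bullet> p = 0"
  shows "curvature p u v w = (v \<bullet> w) *\<^sub>R u - (u \<bullet> w) *\<^sub>R v"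
proof -
  have "lie_bracket (vf_ext u) (vf_ext v) p = 0"
    using assms by (simp add: lie_bracket_def sphere_deriv_vf_ext)
      (simp add: vf_ext_def tangential_tangent inner_commute)
  then have "sphere_nabla (lie_bracket (vf_ext u) (vf_ext v)) (vf_ext w) p = 0"
    using assms by (simp add: sphere_nabla_def sphere_deriv_vf_ext) (simp add: tangential_def)
  then show ?thesis
    using assms by (simp add: curvature_def curvature_field_def sphere_nabla_nabla_vf_ext inner_commute)
qed

text \<open>
  The tangent line of the circle has two orthonormal bases, consisting of one of its two unit vectors
  each. The trace refers to an unspecified one of them, so what follows is stated for any unit
  tangent vector \<open>e\<close>.
\<close>

lemma trace_on_tangent_circle:
  fixes p :: "real ^ 2"
  assumes "norm p = 1"
  obtains e where "norm e = 1" "e \<bullet> p = 0" "\<And>h :: _ \<Rightarrow> _ \<Rightarrow> 'b::real_vector. trace_on (tangent_space p) h = h e e"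
proof -
  let ?V = "tangent_space p"
  let ?B = "SOME B. orthonormal_basis ?V B"
  have V: "subspace ?V"
    by (simp add: tangent_space_def subspace_def inner_left_distrib)
  have "p \<noteq> 0" using assms by auto
  then have dV: "dim ?V = 1"
    using dim_hyperplane[of p] by (simp add: tangent_space_def inner_commute)
  have "\<exists>B. orthonormal_basis ?V B"
    unfolding orthonormal_basis_def by (metis orthonormal_basis_subspace[OF V])
  then have B: "orthonormal_basis ?V ?B" by (rule someI_ex)
  then have "independent ?B"
    unfolding orthonormal_basis_def
    by (intro pairwise_orthogonal_independent) auto
  then have "card ?B = 1"
    using B dV dim_span_eq_card_independent[of ?B] unfolding orthonormal_basis_def by simp
  then obtain e where e: "?B = {e}" by (auto simp: card_1_singleton_iff)
  have "norm e = 1" "e \<bullet> p = 0"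
    using B unfolding e by (auto simp: orthonormal_basis_def tangent_space_def)
  with that show thesis unfolding trace_on_def e by simp
qed

section \<open>Double-angle curves on the unit circle\<close>

text \<open>
  At \<open>p = (cos t, sin t)\<close> this is \<open>A + cos 2t B + sin 2t C\<close>.
\<close>

definition double_angle_circle :: "'b::real_vector \<Rightarrow> 'b \<Rightarrow> 'b \<Rightarrow> real ^ 2 \<Rightarrow> 'b" where
  "double_angle_circle A B C p =
     A + ((p $ 1)\<^sup>2 - (p $ 2)\<^sup>2) *\<^sub>R B + (2 * p $ 1 * p $ 2) *\<^sub>R C"

definition quarter_turn :: "real ^ 2 \<Rightarrow> real ^ 2" where
  "quarter_turn p = vector [- (p $ 2), p $ 1]"

lemma quarter_turn_nth [simp]: "quarter_turn p $ 1 = - (p $ 2)" "quarter_turn p $ 2 = p $ 1"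
  by (simp_all add: quarter_turn_def)

lemma inner_real_2: "x \<bullet> y = x $ 1 * y $ 1 + x $ 2 * y $ 2" for x y :: "real ^ 2"
  by (simp add: inner_vec_def sum_2)

lemma norm_1_real_2: "norm p = 1 \<longleftrightarrow> (p $ 1)\<^sup>2 + (p $ 2)\<^sup>2 = 1" for p :: "real ^ 2"
  by (simp add: norm_eq_1 inner_real_2 power2_eq_square)

lemma tangential_circle:
  assumes "norm p = 1"
  shows "tangential p v = (v \<bullet> quarter_turn p) *\<^sub>R quarter_turn p"
proof -
  have "p $ 1 * p $ 1 = 1 - p $ 2 * p $ 2"
    using assms by (simp add: norm_1_real_2 power2_eq_square)
  then have "v $ 1 - (v $ 1 * p $ 1 + v $ 2 * p $ 2) * p $ 1 = (- v $ 1 * p $ 2 + v $ 2 * p $ 1) * - p $ 2"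
    and "v $ 2 - (v $ 1 * p $ 1 + v $ 2 * p $ 2) * p $ 2 = (- v $ 1 * p $ 2 + v $ 2 * p $ 1) * p $ 1"
    by algebra+
  then show ?thesis
    by (simp add: vec_eq_iff forall_2 tangential_def inner_real_2)
qed

lemma has_derivative_double_angle_circle:
  fixes A B C :: "'b::real_normed_vector"
  shows "(double_angle_circle A B C has_derivative
    (\<lambda>v. (2 * (p $ 1 * v $ 1 - p $ 2 * v $ 2)) *\<^sub>R B + (2 * (p $ 1 * v $ 2 + p $ 2 * v $ 1)) *\<^sub>R C)) (at p)"
  unfolding double_angle_circle_def
  by (auto intro!: derivative_eq_intros bounded_linear.has_derivative[OF bounded_linear_vec_nth]
      simp: algebra_simps power2_eq_square fun_eq_iff)

text \<open>
  Along the unit tangent field \<open>quarter_turn\<close> the derivative rotates \<open>(B, C)\<close> into \<open>2 (C, - B)\<close>; the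
  class of double-angle curves is closed under it.
\<close>

lemma sphere_deriv_double_angle_circle:
  fixes A B C :: "'b::real_normed_vector"
  assumes p: "norm p = 1" and \<sigma>: "\<And>q. norm q = 1 \<Longrightarrow> \<sigma> q = double_angle_circle A B C q"
  shows "sphere_deriv \<sigma> p v = (2 * (v \<bullet> quarter_turn p)) *\<^sub>R double_angle_circle 0 C (- B) p"
  using sphere_deriv_eqI[OF p has_derivative_double_angle_circle \<sigma>, of v]
  by (simp add: tangential_circle[OF p] double_angle_circle_def power2_eq_square algebra_simps
      scaleR_diff_right)

lemma inner_quarter_turn_square:
  assumes "norm p = 1" "norm e = 1" "e \<bullet> p = 0"
  shows "(e \<bullet> quarter_turn p) * (e \<bullet> quarter_turn p) = 1"
proof -
  have "e = (e \<bullet> quarter_turn p) *\<^sub>R quarter_turn p"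
    using tangential_circle[OF assms(1), of e] tangential_tangent[OF assms(3)] by simp
  then have "e \<bullet> e = (e \<bullet> quarter_turn p) * (e \<bullet> quarter_turn p)"
    by (metis inner_scaleR_right)
  then show ?thesis
    using assms(2) by (simp add: norm_eq_1)
qed

text \<open>
  The extension \<open>vf_ext e\<close> of a unit tangent vector \<open>e\<close> is \<open>(e \<bullet> quarter_turn q) quarter_turn q\<close>, so
  second derivatives produce sections with the factor \<open>e \<bullet> quarter_turn q\<close>. At \<open>p\<close> this factor is \<open>1\<close>
  or \<open>- 1\<close> and stationary; the sign cancels against the one in \<open>e = \<plusminus> quarter_turn p\<close>.
\<close>

lemma sphere_deriv_unit_speed_double_angle_circle:
  fixes A B C :: "'b::real_normed_vector"
  assumes p: "norm p = 1" and e: "norm e = 1" "e \<bullet> p = 0"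
    and \<sigma>: "\<And>q. norm q = 1 \<Longrightarrow> \<sigma> q = (e \<bullet> quarter_turn q) *\<^sub>R double_angle_circle A B C q"
  shows "sphere_deriv \<sigma> p e = 2 *\<^sub>R double_angle_circle 0 C (- B) p"
proof -
  let ?D = "\<lambda>v. (2 * (p $ 1 * v $ 1 - p $ 2 * v $ 2)) *\<^sub>R B + (2 * (p $ 1 * v $ 2 + p $ 2 * v $ 1)) *\<^sub>R C"
  have "bounded_linear quarter_turn"
    by (intro linear_conv_bounded_linear[THEN iffD1] linearI) (simp_all add: vec_eq_iff forall_2)
  then have "((\<lambda>q. (e \<bullet> quarter_turn q) *\<^sub>R double_angle_circle A B C q) has_derivative
      (\<lambda>v. (e \<bullet> quarter_turn p) *\<^sub>R ?D v + (e \<bullet> quarter_turn v) *\<^sub>R double_angle_circle A B C p)) (at p)"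
    by (intro has_derivative_scaleR has_derivative_inner_right has_derivative_double_angle_circle
        bounded_linear.has_derivative[of quarter_turn] has_derivative_ident)
  from sphere_deriv_eqI[OF p this \<sigma>, of e]
  have "sphere_deriv \<sigma> p e =
      (e \<bullet> quarter_turn p) *\<^sub>R ?D e + (e \<bullet> quarter_turn e) *\<^sub>R double_angle_circle A B C p"
    using e by (simp add: tangential_tangent)
  also have "e \<bullet> quarter_turn e = 0"
    by (simp add: inner_real_2)
  also have "?D e = (2 * (e \<bullet> quarter_turn p)) *\<^sub>R double_angle_circle 0 C (- B) p"
    using sphere_deriv_double_angle_circle[OF p refl, of A B C e]
      sphere_deriv_eqI[OF p has_derivative_double_angle_circle refl, of A B C e] e(2)
    by (simp add: tangential_tangent)
  also have "(e \<bullet> quarter_turn p) *\<^sub>R \<dots> =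
      (2 * ((e \<bullet> quarter_turn p) * (e \<bullet> quarter_turn p))) *\<^sub>R double_angle_circle 0 C (- B) p"
    by (simp add: mult.left_commute)
  finally show ?thesis
    using inner_quarter_turn_square[OF p e] by simp
qed

lemma double_angle_pythagoras:
  fixes p :: "real ^ 2"
  assumes "norm p = 1"
  shows "((p $ 1)\<^sup>2 - (p $ 2)\<^sup>2)\<^sup>2 + (2 * p $ 1 * p $ 2)\<^sup>2 = 1"
proof -
  have "((p $ 1)\<^sup>2 - (p $ 2)\<^sup>2)\<^sup>2 + (2 * p $ 1 * p $ 2)\<^sup>2 = ((p $ 1)\<^sup>2 + (p $ 2)\<^sup>2)\<^sup>2"
    by algebra
  then show ?thesis
    using assms by (simp add: norm_1_real_2)
qed

lemma double_angle_surj: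
  assumes "s\<^sup>2 + t\<^sup>2 = (1::real)"
  obtains p :: "real ^ 2" where "norm p = 1" "(p $ 1)\<^sup>2 - (p $ 2)\<^sup>2 = s" "2 * p $ 1 * p $ 2 = t"
proof -
  obtain \<theta> where \<theta>: "s = cos \<theta>" "t = sin \<theta>"
    using sincos_total_2pi[OF assms] by metis
  define p :: "real ^ 2" where "p = vector [cos (\<theta> / 2), sin (\<theta> / 2)]"
  have "norm p = 1" by (simp add: norm_1_real_2 p_def)
  moreover have "(p $ 1)\<^sup>2 - (p $ 2)\<^sup>2 = s"
    using cos_double[of "\<theta> / 2"] by (simp add: p_def \<theta>)
  moreover have "2 * p $ 1 * p $ 2 = t"
    using sin_double[of "\<theta> / 2"] by (simp add: p_def \<theta>)
  ultimately show thesis using that by blast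
qed

lemma inner_vf_ext_quarter_turn: "vf_ext e q \<bullet> quarter_turn q = e \<bullet> quarter_turn q"
  by (simp add: vf_ext_def tangential_def inner_diff_left) (simp add: inner_real_2)

section \<open>Tension and bitension of a double-angle circle in the sphere\<close>

text \<open>
  The conditions on \<open>A\<close>, \<open>B\<close>, \<open>C\<close> are equivalent to the curve lying in the unit sphere, with \<open>r\<close>
  the radius of its image up to sign.
\<close>

locale spherical_double_angle_circle =
  fixes \<phi> :: "real ^ 2 \<Rightarrow> 'b::euclidean_space" and A B C :: 'b and r :: real
  assumes \<phi>: "\<And>p. norm p = 1 \<Longrightarrow> \<phi> p = double_angle_circle A B C p"
    and orth: "A \<bullet> B = 0" "A \<bullet> C = 0" "B \<bullet> C = 0"
    and norms: "A \<bullet> A = 1 - r\<^sup>2" "B \<bullet> B = r\<^sup>2" "C \<bullet> C = r\<^sup>2"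
begin

lemma inner_frame:
  "(a *\<^sub>R A + b *\<^sub>R B + c *\<^sub>R C) \<bullet> (a' *\<^sub>R A + b' *\<^sub>R B + c' *\<^sub>R C) =
     a * a' * (1 - r\<^sup>2) + (b * b' + c * c') * r\<^sup>2"
  using orth by (simp add: inner_add inner_commute norms) (simp add: algebra_simps)

abbreviation position :: "real ^ 2 \<Rightarrow> 'b" where
  "position \<equiv> double_angle_circle 0 B C"

abbreviation direction :: "real ^ 2 \<Rightarrow> 'b" where
  "direction \<equiv> double_angle_circle 0 C (- B)"

lemma \<phi>_eq_position: "norm p = 1 \<Longrightarrow> \<phi> p = A + position p"
  by (simp add: \<phi> double_angle_circle_def)

text \<open>
  \<open>position p\<close> and \<open>direction p\<close> arise from \<open>B\<close> and \<open>C\<close> by a rotation, so together with \<open>A\<close> they have the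
  same Gram matrix as \<open>A\<close>, \<open>B\<close>, \<open>C\<close>.
\<close>

lemma inner_moving_frame:
  assumes "norm p = 1"
  shows "(a *\<^sub>R A + b *\<^sub>R position p + c *\<^sub>R direction p) \<bullet> (a' *\<^sub>R A + b' *\<^sub>R position p + c' *\<^sub>R direction p) =
     a * a' * (1 - r\<^sup>2) + (b * b' + c * c') * r\<^sup>2"
proof -
  define x y where "x = (p $ 1)\<^sup>2 - (p $ 2)\<^sup>2" and "y = 2 * p $ 1 * p $ 2"
  have frame: "a *\<^sub>R A + b *\<^sub>R position p + c *\<^sub>R direction p =
      a *\<^sub>R A + (b * x - c * y) *\<^sub>R B + (b * y + c * x) *\<^sub>R C" for a b c
    by (simp add: double_angle_circle_def x_def y_def algebra_simps)
  have "(b * x - c * y) * (b' * x - c' * y) + (b * y + c * x) * (b' * y + c' * x) =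
      (b * b' + c * c') * (x\<^sup>2 + y\<^sup>2)"
    by algebra
  moreover have "x\<^sup>2 + y\<^sup>2 = 1"
    unfolding x_def y_def using assms by (rule double_angle_pythagoras)
  ultimately show ?thesis
    unfolding frame inner_frame by simp
qed

lemma norm_\<phi>: "norm p = 1 \<Longrightarrow> norm (\<phi> p) = 1"
  using inner_moving_frame[of p 1 1 0 1 1 0] by (simp add: norm_eq_1 \<phi>_eq_position)

lemma tangential_moving_frame:
  assumes "norm p = 1"
  shows "tangential (\<phi> p) (a *\<^sub>R position p + b *\<^sub>R direction p) =
    a *\<^sub>R ((1 - r\<^sup>2) *\<^sub>R position p - r\<^sup>2 *\<^sub>R A) + b *\<^sub>R direction p"
  using inner_moving_frame[OF assms, of 0 a b 1 1 0]
  by (simp add: tangential_def \<phi>_eq_position[OF assms] algebra_simps)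

lemma sphere_deriv_\<phi>:
  assumes "norm p = 1"
  shows "sphere_deriv \<phi> p v = (2 * (v \<bullet> quarter_turn p)) *\<^sub>R direction p"
  using assms \<phi> by (rule sphere_deriv_double_angle_circle)

text \<open>
  The tangential part of the acceleration \<open>- 4 position p\<close>: the term of the second fundamental form
  that involves the connection of the circle vanishes, since \<open>vf_ext e\<close> is parallel at \<open>p\<close>.
\<close>

lemma tension_\<phi>:
  assumes p: "norm p = 1"
  shows "tension \<phi> p = 4 *\<^sub>R (r\<^sup>2 *\<^sub>R A + (r\<^sup>2 - 1) *\<^sub>R position p)"
proof -
  obtain e where e: "norm e = 1" "e \<bullet> p = 0"
    and tr: "\<And>h :: _ \<Rightarrow> _ \<Rightarrow> 'b. trace_on (tangent_space p) h = h e e"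
    using trace_on_tangent_circle[OF p] by blast
  have "sphere_deriv \<phi> q (vf_ext e q) = (e \<bullet> quarter_turn q) *\<^sub>R double_angle_circle 0 (2 *\<^sub>R C) (2 *\<^sub>R - B) q"
    if "norm q = 1" for q
    using that by (simp add: sphere_deriv_\<phi> inner_vf_ext_quarter_turn double_angle_circle_def algebra_simps)
  from sphere_deriv_unit_speed_double_angle_circle[OF p e this]
  have "sphere_deriv (\<lambda>q. sphere_deriv \<phi> q (vf_ext e q)) p e = (- 4) *\<^sub>R position p + 0 *\<^sub>R direction p"
    by (simp add: double_angle_circle_def algebra_simps)
  then have "pullback_nabla \<phi> e (\<lambda>q. sphere_deriv \<phi> q (vf_ext e q)) p =
      (- 4) *\<^sub>R ((1 - r\<^sup>2) *\<^sub>R position p - r\<^sup>2 *\<^sub>R A)"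
    unfolding pullback_nabla_def by (simp only: tangential_moving_frame[OF p]) simp
  moreover have "sphere_nabla (vf_ext e) (vf_ext e) p = 0"
    using e by (simp add: sphere_nabla_vf_ext[OF p])
  ultimately show ?thesis
    by (simp add: tension_def tr nabla_d_def sphere_deriv_\<phi>[OF p] algebra_simps)
qed

text \<open>
  The tension is again a double-angle curve, and its first derivative is a multiple of \<open>direction\<close>,
  hence already tangent to the sphere at \<open>\<phi> q\<close>. A projection is needed only after the second
  derivative, where it turns a multiple of \<open>position p\<close> into a multiple of the tension.
\<close>

lemma nabla2_tension_\<phi>:
  assumes p: "norm p = 1" and e: "norm e = 1" "e \<bullet> p = 0"
  shows "nabla2 \<phi> (tension \<phi>) p e e = (- 4 * (1 - r\<^sup>2)) *\<^sub>R tension \<phi> p"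
proof -
  let ?k = "- 4 * (1 - r\<^sup>2)"
  have \<tau>: "tension \<phi> q = double_angle_circle ((4 * r\<^sup>2) *\<^sub>R A) (?k *\<^sub>R B) (?k *\<^sub>R C) q"
    if "norm q = 1" for q
    by (simp add: tension_\<phi>[OF that] double_angle_circle_def algebra_simps)
  have d\<tau>: "sphere_deriv (tension \<phi>) q v = 0 *\<^sub>R position q + (2 * ?k * (v \<bullet> quarter_turn q)) *\<^sub>R direction q"
    if "norm q = 1" for q v
    using sphere_deriv_double_angle_circle[OF that \<tau>, of v]
    by (simp add: double_angle_circle_def algebra_simps)
  have nab: "pullback_nabla \<phi> v (tension \<phi>) q = (2 * ?k * (v \<bullet> quarter_turn q)) *\<^sub>R direction q"
    if "norm q = 1" for q v
    unfolding pullback_nabla_def d\<tau>[OF that] tangential_moving_frame[OF that] by simp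
  have "pullback_nabla \<phi> (vf_ext e q) (tension \<phi>) q =
      (e \<bullet> quarter_turn q) *\<^sub>R double_angle_circle 0 ((2 * ?k) *\<^sub>R C) ((2 * ?k) *\<^sub>R - B) q"
    if "norm q = 1" for q
    by (simp add: nab[OF that] inner_vf_ext_quarter_turn double_angle_circle_def algebra_simps)
  from sphere_deriv_unit_speed_double_angle_circle[OF p e this]
  have "sphere_deriv (\<lambda>q. pullback_nabla \<phi> (vf_ext e q) (tension \<phi>) q) p e =
      (- 4 * ?k) *\<^sub>R position p + 0 *\<^sub>R direction p"
    by (simp add: double_angle_circle_def algebra_simps)
  then have "pullback_nabla \<phi> e (\<lambda>q. pullback_nabla \<phi> (vf_ext e q) (tension \<phi>) q) p =
      (- 4 * ?k) *\<^sub>R ((1 - r\<^sup>2) *\<^sub>R position p - r\<^sup>2 *\<^sub>R A)"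
    unfolding pullback_nabla_def[of \<phi> e] by (simp only: tangential_moving_frame[OF p]) simp
  moreover have "sphere_nabla (vf_ext e) (vf_ext e) p = 0"
    using e by (simp add: sphere_nabla_vf_ext[OF p])
  ultimately show ?thesis
    by (simp add: nabla2_def nab[OF p] tension_\<phi>[OF p] algebra_simps)
qed

text \<open>
  The tension is orthogonal to the velocity, so of the two terms of the curvature tensor only the one
  with the squared speed \<open>4 r\<^sup>2\<close> remains.
\<close>

lemma curvature_tension_\<phi>:
  assumes p: "norm p = 1" and e: "norm e = 1" "e \<bullet> p = 0"
  shows "curvature (\<phi> p) (sphere_deriv \<phi> p e) (tension \<phi> p) (sphere_deriv \<phi> p e) =
    (- 4 * r\<^sup>2) *\<^sub>R tension \<phi> p"
proof -
  define s where "s = 2 * (e \<bullet> quarter_turn p)"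
  have s: "s * s = 4"
    using inner_quarter_turn_square[OF p e] by (simp add: s_def)
  have "direction p \<bullet> \<phi> p = 0" "direction p \<bullet> tension \<phi> p = 0" "direction p \<bullet> direction p = r\<^sup>2"
    using inner_moving_frame[OF p, of 0 0 1 1 1 0] inner_moving_frame[OF p, of 0 0 1 0 0 1]
      inner_moving_frame[OF p, of 0 0 1 "r\<^sup>2" "r\<^sup>2 - 1" 0]
    by (simp_all add: \<phi>_eq_position[OF p] tension_\<phi>[OF p])
  moreover have "tension \<phi> p \<bullet> \<phi> p = 0"
    using inner_moving_frame[OF p, of "r\<^sup>2" "r\<^sup>2 - 1" 0 1 1 0]
    by (simp add: \<phi>_eq_position[OF p] tension_\<phi>[OF p]) (simp add: algebra_simps)
  ultimately show ?thesis
    using s by (simp add: sphere_deriv_\<phi>[OF p] curvature_sphere norm_\<phi>[OF p] inner_commute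
        flip: s_def mult.assoc)
qed

lemma bitension_\<phi>:
  assumes p: "norm p = 1"
  shows "bitension \<phi> p = (4 * (2 * r\<^sup>2 - 1)) *\<^sub>R tension \<phi> p"
proof -
  obtain e where e: "norm e = 1" "e \<bullet> p = 0"
    and tr: "\<And>h :: _ \<Rightarrow> _ \<Rightarrow> 'b. trace_on (tangent_space p) h = h e e"
    using trace_on_tangent_circle[OF p] by blast
  show ?thesis
    unfolding bitension_def rough_laplacian_def tr nabla2_tension_\<phi>[OF p e] curvature_tension_\<phi>[OF p e]
    by (simp flip: scaleR_left_diff_distrib scaleR_add_left scaleR_minus_left)
qed

lemma tension_\<phi>_eq_0_iff:
  assumes p: "norm p = 1" and r: "r \<noteq> 0"
  shows "tension \<phi> p = 0 \<longleftrightarrow> r\<^sup>2 = 1"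
proof
  assume "tension \<phi> p = 0"
  then have "position p \<bullet> (r\<^sup>2 *\<^sub>R A + (r\<^sup>2 - 1) *\<^sub>R position p) = 0"
    by (simp add: tension_\<phi>[OF p])
  then show "r\<^sup>2 = 1"
    using inner_moving_frame[OF p, of 0 1 0 "r\<^sup>2" "r\<^sup>2 - 1" 0] r by simp
next
  assume "r\<^sup>2 = 1"
  moreover from this norms have "A = 0" by simp
  ultimately show "tension \<phi> p = 0" by (simp add: tension_\<phi>[OF p])
qed

text \<open>
  The bitension is the constant \<open>4 (2 r\<^sup>2 - 1)\<close> times the tension, and the tension of a curve with
  \<open>r \<noteq> 0\<close> vanishes at one point exactly when it vanishes everywhere.
\<close>

lemma proper_biharmonic_\<phi>_iff:
  assumes r: "r \<noteq> 0"
  shows "proper_biharmonic \<phi> \<longleftrightarrow> r\<^sup>2 = 1 / 2"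
proof -
  obtain p :: "real ^ 2" where "norm p = 1"
    using vector_choose_size[of 1] by auto
  then have "harmonic_map \<phi> \<longleftrightarrow> r\<^sup>2 = 1"
    using tension_\<phi>_eq_0_iff[OF _ r] by (auto simp: harmonic_map_def)
  moreover have "biharmonic_map \<phi> \<longleftrightarrow> r\<^sup>2 = 1 \<or> r\<^sup>2 = 1 / 2"
    using tension_\<phi>_eq_0_iff[OF _ r] \<open>norm p = 1\<close>
    by (auto simp: biharmonic_map_def bitension_\<phi>)
  ultimately show ?thesis
    by (auto simp: proper_biharmonic_def)
qed

lemma image_\<phi>: "\<phi> ` sphere 0 1 = {A + s *\<^sub>R B + t *\<^sub>R C |s t. s\<^sup>2 + t\<^sup>2 = 1}"
proof (intro subset_antisym subsetI)
  fix x assume "x \<in> \<phi> ` sphere 0 1"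
  then obtain p where p: "norm p = 1" "x = \<phi> p" by auto
  then show "x \<in> {A + s *\<^sub>R B + t *\<^sub>R C |s t. s\<^sup>2 + t\<^sup>2 = 1}"
    using double_angle_pythagoras[of p] by (auto simp: \<phi> double_angle_circle_def)
next
  fix x assume "x \<in> {A + s *\<^sub>R B + t *\<^sub>R C |s t. s\<^sup>2 + t\<^sup>2 = 1}"
  then obtain s t where x: "x = A + s *\<^sub>R B + t *\<^sub>R C" and "s\<^sup>2 + t\<^sup>2 = 1" by auto
  then obtain p :: "real ^ 2" where p: "norm p = 1" "(p $ 1)\<^sup>2 - (p $ 2)\<^sup>2 = s" "2 * p $ 1 * p $ 2 = t"
    using double_angle_surj by metis
  then have "x = \<phi> p" unfolding x by (simp add: \<phi> double_angle_circle_def)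
  then show "x \<in> \<phi> ` sphere 0 1" using p(1) by auto
qed

lemma circle_of_sphere_image_\<phi>:
  assumes r: "r > 0"
  shows "circle_of_sphere r (\<phi> ` sphere 0 1)"
proof -
  let ?P = "(+) A ` span {B, C}"
  have nz: "B \<noteq> 0" "C \<noteq> 0" using norms r by auto
  have "B \<noteq> C" using orth norms r by auto
  have "independent {B, C}"
    using nz orth by (intro pairwise_orthogonal_independent) (auto simp: pairwise_insert orthogonal_def inner_commute)
  then have "dim {B, C} = 2"
    using \<open>B \<noteq> C\<close> by (simp add: dim_eq_card_independent)
  then have "aff_dim ?P = 2"
    by (simp add: aff_dim_translation_eq aff_dim_subspace)
  moreover have "affine ?P"
    using affine_translation subspace_imp_affine subspace_span by blast
  moreover have "A \<in> ?P"
    using span_zero by force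
  moreover have "\<phi> ` sphere 0 1 = sphere A r \<inter> ?P"
  proof -
    have P: "?P = {A + s *\<^sub>R B + t *\<^sub>R C |s t. True}"
      by (force simp: span_insert span_singleton set_eq_iff image_iff algebra_simps)
    have "A + s *\<^sub>R B + t *\<^sub>R C \<in> sphere A r \<longleftrightarrow> s\<^sup>2 + t\<^sup>2 = 1" for s t
    proof -
      have "dist A (A + s *\<^sub>R B + t *\<^sub>R C) = sqrt ((s\<^sup>2 + t\<^sup>2) * r\<^sup>2)"
        using inner_frame[of 0 "- s" "- t" 0 "- s" "- t"]
        by (simp add: dist_norm norm_eq_sqrt_inner power2_eq_square)
      also have "\<dots> = sqrt (s\<^sup>2 + t\<^sup>2) * r"
        using r by (simp add: real_sqrt_mult)
      finally show ?thesis using r by auto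
    qed
    then show ?thesis unfolding image_\<phi> P by blast
  qed
  moreover have "\<phi> ` sphere 0 1 \<subseteq> sphere 0 1"
    using norm_\<phi> by auto
  ultimately show ?thesis unfolding circle_of_sphere_def by blast
qed

end

section \<open>Quadratic forms on the circle are double-angle circles\<close>

lemma homogeneous_quadratic_poly_real_2:
  fixes f :: "real ^ 2 \<Rightarrow> real"
  shows "homogeneous_quadratic_poly f \<longleftrightarrow>
    (\<exists>\<alpha> \<beta> \<gamma>. \<forall>x. f x = \<alpha> * (x $ 1)\<^sup>2 + \<beta> * (x $ 2)\<^sup>2 + \<gamma> * (x $ 1 * x $ 2))"
proof -
  have ne: "axis 1 1 \<noteq> (axis 2 1 :: real ^ 2)"
    by (simp add: axis_eq_axis)
  have Basis: "(Basis :: (real ^ 2) set) = {axis 1 1, axis 2 1}"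
    by (auto simp: Basis_vec_def UNIV_2)
  have sum: "(\<Sum>i\<in>Basis. \<Sum>j\<in>Basis. a i j * (x \<bullet> i) * (x \<bullet> j)) =
      a (axis 1 1) (axis 1 1) * (x $ 1)\<^sup>2 + a (axis 2 1) (axis 2 1) * (x $ 2)\<^sup>2 +
      (a (axis 1 1) (axis 2 1) + a (axis 2 1) (axis 1 1)) * (x $ 1 * x $ 2)" for a and x :: "real ^ 2"
    unfolding Basis using ne by (simp add: inner_axis) (simp add: power2_eq_square algebra_simps)
  show ?thesis
  proof
    assume "homogeneous_quadratic_poly f"
    then show "\<exists>\<alpha> \<beta> \<gamma>. \<forall>x. f x = \<alpha> * (x $ 1)\<^sup>2 + \<beta> * (x $ 2)\<^sup>2 + \<gamma> * (x $ 1 * x $ 2)"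
      unfolding homogeneous_quadratic_poly_def sum by blast
  next
    assume "\<exists>\<alpha> \<beta> \<gamma>. \<forall>x. f x = \<alpha> * (x $ 1)\<^sup>2 + \<beta> * (x $ 2)\<^sup>2 + \<gamma> * (x $ 1 * x $ 2)"
    then obtain \<alpha> \<beta> \<gamma> where f: "\<And>x. f x = \<alpha> * (x $ 1)\<^sup>2 + \<beta> * (x $ 2)\<^sup>2 + \<gamma> * (x $ 1 * x $ 2)" by blast
    define a :: "real ^ 2 \<Rightarrow> real ^ 2 \<Rightarrow> real" where
      "a i j = (if i = j then if i = axis 1 1 then \<alpha> else \<beta> else \<gamma> / 2)" for i j
    have "f x = (\<Sum>i\<in>Basis. \<Sum>j\<in>Basis. a i j * (x \<bullet> i) * (x \<bullet> j))" for x
      unfolding sum f using ne by (simp add: a_def)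
    then show "homogeneous_quadratic_poly f"
      unfolding homogeneous_quadratic_poly_def by blast
  qed
qed

lemma homogeneous_quadratic_components_iff:
  fixes F :: "real ^ 2 \<Rightarrow> 'b::euclidean_space"
  shows "(\<forall>b\<in>Basis. homogeneous_quadratic_poly (\<lambda>x. F x \<bullet> b)) \<longleftrightarrow>
    (\<exists>P Q R. \<forall>x. F x = (x $ 1)\<^sup>2 *\<^sub>R P + (x $ 2)\<^sup>2 *\<^sub>R Q + (x $ 1 * x $ 2) *\<^sub>R R)"
proof
  assume "\<forall>b\<in>Basis. homogeneous_quadratic_poly (\<lambda>x. F x \<bullet> b)"
  then obtain \<alpha> \<beta> \<gamma> where coords:
    "\<And>b x. b \<in> Basis \<Longrightarrow> F x \<bullet> b = \<alpha> b * (x $ 1)\<^sup>2 + \<beta> b * (x $ 2)\<^sup>2 + \<gamma> b * (x $ 1 * x $ 2)"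
    unfolding homogeneous_quadratic_poly_real_2 by metis
  have "F x = (x $ 1)\<^sup>2 *\<^sub>R (\<Sum>b\<in>Basis. \<alpha> b *\<^sub>R b) + (x $ 2)\<^sup>2 *\<^sub>R (\<Sum>b\<in>Basis. \<beta> b *\<^sub>R b) +
      (x $ 1 * x $ 2) *\<^sub>R (\<Sum>b\<in>Basis. \<gamma> b *\<^sub>R b)" for x
    by (rule euclidean_eqI) (simp add: coords inner_add_left)
  then show "\<exists>P Q R. \<forall>x. F x = (x $ 1)\<^sup>2 *\<^sub>R P + (x $ 2)\<^sup>2 *\<^sub>R Q + (x $ 1 * x $ 2) *\<^sub>R R"
    by blast
next
  assume "\<exists>P Q R. \<forall>x. F x = (x $ 1)\<^sup>2 *\<^sub>R P + (x $ 2)\<^sup>2 *\<^sub>R Q + (x $ 1 * x $ 2) *\<^sub>R R"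
  then obtain P Q R where "\<And>x. F x = (x $ 1)\<^sup>2 *\<^sub>R P + (x $ 2)\<^sup>2 *\<^sub>R Q + (x $ 1 * x $ 2) *\<^sub>R R"
    by blast
  then have "F x \<bullet> b = (P \<bullet> b) * (x $ 1)\<^sup>2 + (Q \<bullet> b) * (x $ 2)\<^sup>2 + (R \<bullet> b) * (x $ 1 * x $ 2)" for x b
    by (simp add: inner_add_left mult.commute)
  then show "\<forall>b\<in>Basis. homogeneous_quadratic_poly (\<lambda>x. F x \<bullet> b)"
    unfolding homogeneous_quadratic_poly_real_2 by blast
qed

lemma quadratic_eq_double_angle_circle:
  fixes P Q R :: "'b::real_vector"
  assumes "norm p = 1"
  shows "(p $ 1)\<^sup>2 *\<^sub>R P + (p $ 2)\<^sup>2 *\<^sub>R Q + (p $ 1 * p $ 2) *\<^sub>R R =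
    double_angle_circle ((1/2) *\<^sub>R (P + Q)) ((1/2) *\<^sub>R (P - Q)) ((1/2) *\<^sub>R R) p"
proof -
  define s where "s = (p $ 1)\<^sup>2 - (p $ 2)\<^sup>2"
  have "(p $ 1)\<^sup>2 = (1 + s) / 2" "(p $ 2)\<^sup>2 = (1 - s) / 2"
    using assms by (simp_all add: s_def norm_1_real_2)
  then show ?thesis
    unfolding double_angle_circle_def s_def[symmetric]
    by (simp only:) (simp add: add_divide_distrib diff_divide_distrib algebra_simps)
qed

text \<open>
  The point \<open>(s, t) = (cos 2\<theta>, sin 2\<theta>)\<close> ranges over the whole unit circle, and \<open>|\<psi>|\<^sup>2 = 1\<close> is a
  quadratic equation in \<open>(s, t)\<close>. The four axis points and one further point determine
  its coefficients.
\<close>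

lemma spherical_double_angle_circleI:
  fixes \<psi> :: "real ^ 2 \<Rightarrow> 'b::euclidean_space"
  assumes \<psi>: "\<And>p. norm p = 1 \<Longrightarrow> \<psi> p = double_angle_circle A B C p"
    and sphere: "\<And>p. norm p = 1 \<Longrightarrow> norm (\<psi> p) = 1"
  shows "spherical_double_angle_circle \<psi> A B C (norm B)"
proof -
  have *: "A \<bullet> A + s\<^sup>2 * (B \<bullet> B) + t\<^sup>2 * (C \<bullet> C) + 2 * s * (A \<bullet> B) + 2 * t * (A \<bullet> C) + 2 * s * t * (B \<bullet> C) = 1"
    if st: "s\<^sup>2 + t\<^sup>2 = 1" for s t
  proof -
    obtain p :: "real ^ 2" where p: "norm p = 1" "(p $ 1)\<^sup>2 - (p $ 2)\<^sup>2 = s" "2 * p $ 1 * p $ 2 = t"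
      using st by (rule double_angle_surj)
    then have "norm (A + s *\<^sub>R B + t *\<^sub>R C) = 1"
      using \<psi>[OF p(1)] sphere[OF p(1)] by (simp add: double_angle_circle_def)
    then show ?thesis
      by (simp add: norm_eq_1 inner_add inner_commute power2_eq_square algebra_simps)
  qed
  \<comment> \<open>any rational point off the axes isolates \<open>B \<bullet> C\<close>\<close>
  have "A \<bullet> B = 0" "A \<bullet> C = 0" "B \<bullet> C = 0" "B \<bullet> B = C \<bullet> C" "A \<bullet> A + B \<bullet> B = 1"
    using *[of 1 0] *[of "-1" 0] *[of 0 1] *[of 0 "-1"] *[of "3/5" "4/5"]
    by (simp_all add: power2_eq_square)
  then show ?thesis
    using \<psi> by unfold_locales (simp_all add: power2_norm_eq_inner)
qed

text \<open>
  Since \<open>1 = x\<^sup>2 + y\<^sup>2\<close> on the circle, the constant term \<open>A\<close> is itself a homogeneous quadratic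
  polynomial there, so the correspondence goes both ways. Non-constancy means \<open>r > 0\<close>.
\<close>

lemma quadratic_form_spheres_iff:
  fixes \<psi> :: "real ^ 2 \<Rightarrow> 'b::euclidean_space"
  shows "quadratic_form_spheres \<psi> \<longleftrightarrow>
    (\<exists>A B C r. r > 0 \<and> spherical_double_angle_circle \<psi> A B C r)"
proof
  assume L: "quadratic_form_spheres \<psi>"
  then obtain F where F: "\<forall>b\<in>Basis. homogeneous_quadratic_poly (\<lambda>x. F x \<bullet> b)"
    "F ` sphere 0 1 \<subseteq> sphere 0 1" "\<And>p. norm p = 1 \<Longrightarrow> \<psi> p = F p"
    and nc: "\<not> \<psi> constant_on sphere 0 1"
    by (auto simp: quadratic_form_spheres_def)
  then obtain P Q R where "\<And>x. F x = (x $ 1)\<^sup>2 *\<^sub>R P + (x $ 2)\<^sup>2 *\<^sub>R Q + (x $ 1 * x $ 2) *\<^sub>R R"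
    unfolding homogeneous_quadratic_components_iff by blast
  then obtain A B C where \<psi>: "\<And>p. norm p = 1 \<Longrightarrow> \<psi> p = double_angle_circle A B C p"
    using F(3) quadratic_eq_double_angle_circle[of _ P Q R] that by simp
  moreover have "norm (\<psi> p) = 1" if "norm p = 1" for p
    using F that by (auto simp: image_subset_iff)
  ultimately interpret spherical_double_angle_circle \<psi> A B C "norm B"
    by (rule spherical_double_angle_circleI)
  have "norm B \<noteq> 0"
  proof
    assume "norm B = 0"
    then have "\<psi> p = A" if "norm p = 1" for p
      using norms \<psi>[OF that] by (simp add: double_angle_circle_def)
    then show False
      using nc by (auto simp: constant_on_def)
  qed
  then show "\<exists>A B C r. r > 0 \<and> spherical_double_angle_circle \<psi> A B C r"
    using spherical_double_angle_circle_axioms by (metis norm_ge_zero order_le_less)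
next
  assume "\<exists>A B C r. r > 0 \<and> spherical_double_angle_circle \<psi> A B C r"
  then obtain A B C r where "r > 0" and "spherical_double_angle_circle \<psi> A B C r" by blast
  then interpret spherical_double_angle_circle \<psi> A B C r by simp
  define F where "F x = (x $ 1)\<^sup>2 *\<^sub>R (A + B) + (x $ 2)\<^sup>2 *\<^sub>R (A - B) + (x $ 1 * x $ 2) *\<^sub>R (2 *\<^sub>R C)"
    for x :: "real ^ 2"
  have half: "(1/2) *\<^sub>R (A + B + (A - B)) = A" "(1/2) *\<^sub>R (A + B - (A - B)) = B"
    by (simp_all flip: scaleR_2)
  have F: "\<psi> p = F p" if "norm p = 1" for p
    using quadratic_eq_double_angle_circle[OF that, of "A + B" "A - B" "2 *\<^sub>R C"] \<phi>[OF that]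
    by (simp only: F_def half) simp
  moreover have "\<forall>b\<in>Basis. homogeneous_quadratic_poly (\<lambda>x. F x \<bullet> b)"
    unfolding homogeneous_quadratic_components_iff F_def by blast
  moreover have "F ` sphere 0 1 \<subseteq> sphere 0 1"
    using norm_\<phi> F by (force simp: image_subset_iff)
  moreover have "\<not> \<psi> constant_on sphere 0 1"
  proof
    assume "\<psi> constant_on sphere 0 1"
    then have "\<psi> (axis 1 1) = \<psi> (axis 2 1)"
      by (auto simp: constant_on_def)
    moreover have "\<psi> (axis 1 1) = A + B" "\<psi> (axis 2 1) = A - B"
      by (simp_all add: \<phi> double_angle_circle_def) (simp_all add: axis_def)
    ultimately have "2 *\<^sub>R B = 0"
      by (simp add: scaleR_2 algebra_simps)
    then show False using norms \<open>r > 0\<close> by simp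
  qed
  ultimately show "quadratic_form_spheres \<psi>"
    unfolding quadratic_form_spheres_def by auto
qed

lemma spherical_double_angle_circles_congruent:
  fixes \<phi> \<psi> :: "real ^ 2 \<Rightarrow> 'b::euclidean_space"
  assumes "spherical_double_angle_circle \<phi> A B C r" "spherical_double_angle_circle \<psi> A' B' C' r"
  shows "\<exists>T. orthogonal_transformation T \<and> (\<forall>p\<in>sphere 0 1. \<psi> p = T (\<phi> p))"
proof -
  interpret \<phi>: spherical_double_angle_circle \<phi> A B C r by fact
  interpret \<psi>: spherical_double_angle_circle \<psi> A' B' C' r by fact
  have gram: "[A, B, C] ! i \<bullet> [A, B, C] ! j = [A', B', C'] ! i \<bullet> [A', B', C'] ! j"
    if "i \<in> {0, 1, 2}" "j \<in> {0, 1, 2}" for i j :: nat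
    using that \<phi>.orth \<phi>.norms \<psi>.orth \<psi>.norms by (auto simp: inner_commute)
  have "\<exists>T. orthogonal_transformation T \<and> (\<forall>i\<in>{0, 1, 2}. T ([A, B, C] ! i) = [A', B', C'] ! i)"
    by (rule orthogonal_transformation_of_gram_eq) (use gram in auto)
  then obtain T where T: "orthogonal_transformation T" "T A = A'" "T B = B'" "T C = C'"
    by auto
  interpret T: linear T
    using T(1) by (simp add: orthogonal_transformation_def)
  have "\<psi> p = T (\<phi> p)" if "norm p = 1" for p
    by (simp add: \<phi>.\<phi> \<psi>.\<phi> that double_angle_circle_def T.add T.scaleR T)
  with T(1) show ?thesis by auto
qed



section \<open>The proper biharmonic quadratic forms\<close>

theorem theorem4p9:
  fixes c \<gamma> :: "real ^ 'n"
    and F \<phi> :: "real ^ 2 \<Rightarrow> real \<times> (real ^ 'n)"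
  assumes n: "CARD('n) \<ge> 2"
    and F: "\<And>v. F v = ((v $ 1)\<^sup>2, \<chi> i. c $ i * (v $ 2)\<^sup>2 + 2 * \<gamma> $ i * v $ 1 * v $ 2)"
    and c: "(\<Sum>i\<in>UNIV. (c $ i)\<^sup>2) = 1"
    and c\<gamma>: "(\<Sum>i\<in>UNIV. c $ i * \<gamma> $ i) = 0"
    and \<gamma>: "(\<Sum>i\<in>UNIV. (\<gamma> $ i)\<^sup>2) = 1 / 2"
    and \<phi>: "\<And>p. p \<in> sphere 0 1 \<Longrightarrow> \<phi> p = F p"
  shows "quadratic_form_spheres \<phi> \<and> proper_biharmonic \<phi> \<and>
    (\<forall>\<psi> :: real ^ 2 \<Rightarrow> real \<times> (real ^ 'n).
       quadratic_form_spheres \<psi> \<and> proper_biharmonic \<psi> \<longrightarrow>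
       (\<exists>S T. orthogonal_transformation S \<and> orthogonal_transformation T \<and>
          (\<forall>p\<in>sphere 0 1. \<psi> p = T (\<phi> (S p))))) \<and>
    circle_of_sphere (1 / sqrt 2) (\<phi> ` sphere 0 1)"
proof (intro conjI allI impI)
  let ?A = "(1 / 2, (1 / 2) *\<^sub>R c)" and ?B = "(1 / 2, - ((1 / 2) *\<^sub>R c))" and ?C = "(0, \<gamma>)"
  let ?r = "1 / sqrt 2 :: real"
  have inner: "c \<bullet> c = 1" "c \<bullet> \<gamma> = 0" "\<gamma> \<bullet> \<gamma> = 1 / 2"
    using c c\<gamma> \<gamma> by (simp_all add: inner_vec_def power2_eq_square)
  have r: "?r > 0" "?r\<^sup>2 = 1 / 2"
    by (simp_all add: power_divide)
  have "\<phi> p = double_angle_circle ?A ?B ?C p" if "norm p = 1" for p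
  proof -
    have p2: "(p $ 1)\<^sup>2 = 1 - (p $ 2)\<^sup>2"
      using that by (simp add: norm_1_real_2)
    show ?thesis
      using that
      by (simp add: \<phi> F double_angle_circle_def p2 vec_eq_iff) (simp add: field_simps)
  qed
  then interpret \<phi>: spherical_double_angle_circle \<phi> ?A ?B ?C ?r
    using inner r(2) by unfold_locales (simp_all add: inner_commute)
  show "quadratic_form_spheres \<phi>"
    using r(1) \<phi>.spherical_double_angle_circle_axioms quadratic_form_spheres_iff by blast
  show "proper_biharmonic \<phi>"
    using \<phi>.proper_biharmonic_\<phi>_iff r by simp
  show "circle_of_sphere ?r (\<phi> ` sphere 0 1)"
    using r(1) by (rule \<phi>.circle_of_sphere_image_\<phi>)
  fix \<psi> :: "real ^ 2 \<Rightarrow> real \<times> (real ^ 'n)"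
  assume \<psi>: "quadratic_form_spheres \<psi> \<and> proper_biharmonic \<psi>"
  then obtain A B C r' where "r' > 0" and \<psi>': "spherical_double_angle_circle \<psi> A B C r'"
    unfolding quadratic_form_spheres_iff by blast
  then have "r'\<^sup>2 = 1 / 2"
    using \<psi> spherical_double_angle_circle.proper_biharmonic_\<phi>_iff[OF \<psi>'] by simp
  then have "r' = ?r"
    using \<open>r' > 0\<close> r by (metis less_imp_le power2_eq_imp_eq)
  then obtain T where "orthogonal_transformation T" "\<forall>p\<in>sphere 0 1. \<psi> p = T (\<phi> p)"
    using spherical_double_angle_circles_congruent[OF \<phi>.spherical_double_angle_circle_axioms] \<psi>' by blast
  then show "\<exists>S T. orthogonal_transformation S \<and> orthogonal_transformation T \<and>
      (\<forall>p\<in>sphere 0 1. \<psi> p = T (\<phi> (S p)))"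
    by (intro exI[of _ "\<lambda>p. p"] exI[of _ T]) simp
qed

end
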